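(* Let $(Z,\mu)$ be a measured space with $\mu(Z)$ finite, and $(B_i(\epsilon))_{i\in I,\ \epsilon\in]0,+\infty[}$ a family of measurable subsets of $Z$, non-decreasing in $\epsilon$ (for the inclusion), endowed with a map $i\mapsto n_i$ from $I$ to $\mathbb{N}$ such that $I_n=\{i\in I : n_i=n\}$ is finite for every $n$. Let $f_1,f_2,f_3,f_4$ be maps from $\mathbb{N}$ to $]0,+\infty[$ and $f_5$ a map from $]0,+\infty[$ to itself. Let $E$ be the (measurable) set of points in $Z$ belonging to infinitely many subsets $B_i(f_3(n_i))$ for $i$ in $I$. [A] Assume that $f_3\leq f_2$ and that there exists $c\geq 1$ such that, for every $n\in\mathbb{N}$, $i\in I$ and $\epsilon\in\,]0,f_2(n_i)]$, one has $\mathrm{Card}\, I_n \leq c f_1(n)$ and $\mu(B_i(\epsilon)) \leq c f_4(n_i)f_5(\epsilon)$. If the series $\sum_{n=0}^\infty f_1(n) f_4(n) f_5(f_3(n))$ converges, then $\mu(E)=0$. [B] Assume that there exists $c\geq 1$ such that (1) $f_3\leq f_2$; (2) $\frac{1}{f_5\circ f_2}\leq f_4f_1$; (3) there exist $c',c''>1$ such that for every $\epsilon,\epsilon'>0$, if $\epsilon'\leq c'\epsilon$, then $f_5(\epsilon')\leq c''f_5(\epsilon)$; (4) for every $n\in\mathbb{N}$, one has $\frac{1}{c} f_1(n) \leq \mathrm{Card}\, I_n \leq c f_1(n)$; (5) for every $i\in I$ and $\epsilon\in\,]0,f_2(n_i)]$, we have $\frac{1}{c} f_4(n_i)f_5(\epsilon)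 \leq \mu(B_i(\epsilon)) \leq c f_4(n_i)f_5(\epsilon)$; (6) for every $n\in\mathbb{N}$, the subsets $B_i(f_2(n))$ for $i\in I_n$ are pairwise disjoint; (7) for every $i,j\in I$ with $n_i<n_j$, if the intersection of $B_j(f_3(n_j))$ and $B_i(f_3(n_i))$ is non empty, then $B_j(f_2(n_j))$ is contained in $B_i(cf_3(n_i))$. If the series $\sum_{n=0}^\infty f_1(n) f_4(n) f_5(f_3(n))$ diverges, then $\mu(E)>0$. *)

theory Defs
  imports "HOL-Analysis.Analysis"
begin

end

theory Submission
  imports Defs
begin

text \<open>Put \<open>A k = (\<Union>i\<in>I k. B i (f3 k))\<close> and \<open>a k = f1 k * f4 k * f5 (f3 k)\<close>. Every \<open>I k\<close> is
  finite, so \<open>E = limsup A\<close>, and \<open>measure (A k)\<close> is comparable with \<open>a k\<close>. Part [A] is the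
  Borel-Cantelli lemma. For [B], hypothesis (7) and the disjointness of the balls of radius
  \<open>f2 k\<close> bound the number of balls of level \<open>k\<close> that meet a given ball of level \<open>j < k\<close>, which
  together with (2) gives \<open>measure (A j \<inter> A k) \<le> K * a j * a k\<close>; the second moment method then yields a
  positive lower bound on the measure of the limit superior. The bound on intersections needs
  \<open>c * f3 j \<le> f2 j\<close>. If this fails for infinitely many \<open>j\<close>, then doubling and (2) bound \<open>a j\<close>
  from below for these \<open>j\<close>, and positivity is immediate.\<close>

section \<open>Limits superior of events and the second moment method\<close>

lemma (in finite_measure) measure_limsup_ge:
  assumes [measurable]: "\<And>k. A k \<in> sets M"
    and ge: "\<And>m. \<delta> \<le> measure M (\<Union>k\<in>{m..}. A k)"
  shows "\<delta> \<le> measure M (limsup A)"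
proof -
  have "(\<lambda>m. measure M (\<Union>k\<in>{m..}. A k)) \<longlonglongrightarrow> measure M (\<Inter>m. \<Union>k\<in>{m..}. A k)"
    by (intro finite_Lim_measure_decseq) (auto simp: decseq_def intro: order_trans)
  moreover have "limsup A = (\<Inter>m. \<Union>k\<in>{m..}. A k)"
    by (simp add: limsup_INF_SUP)
  ultimately show ?thesis
    using ge by (auto intro: LIMSEQ_le_const)
qed

text \<open>A division-free form of the Cauchy-Schwarz bound, obtained by integrating
  \<open>(S - t * indicator U)\<^sup>2 \<ge> 0\<close>, where \<open>S\<close> is the sum of the indicators and \<open>U\<close> the union.\<close>

lemma (in finite_measure) second_moment_bound:
  fixes t :: real
  assumes fin: "finite S" and meas [measurable]: "\<And>k. A k \<in> sets M"
  shows "2 * t * (\<Sum>k\<in>S. measure M (A k)) - t\<^sup>2 * measure M (\<Union>k\<in>S. A k)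
           \<le> (\<Sum>j\<in>S. \<Sum>k\<in>S. measure M (A j \<inter> A k))"
proof -
  let ?U = "\<Union>k\<in>S. A k"
  let ?f = "\<lambda>x. 2 * t * (\<Sum>k\<in>S. indicator (A k) x) - t\<^sup>2 * indicator ?U x :: real"
  let ?g = "\<lambda>x. (\<Sum>j\<in>S. \<Sum>k\<in>S. indicator (A j \<inter> A k) x) :: real"
  have [measurable]: "?U \<in> sets M" using fin by (intro sets.finite_UN) auto
  have f: "has_bochner_integral M ?f (2 * t * (\<Sum>k\<in>S. measure M (A k)) - t\<^sup>2 * measure M ?U)"
    by (intro has_bochner_integral_diff has_bochner_integral_mult_right has_bochner_integral_sum
          has_bochner_integral_real_indicator) (simp_all add: less_top[symmetric])
  have g: "has_bochner_integral M ?g (\<Sum>j\<in>S. \<Sum>k\<in>S. measure M (A j \<inter> A k))"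
    by (intro has_bochner_integral_sum has_bochner_integral_real_indicator)
      (simp_all add: less_top[symmetric])
  have le: "?f x \<le> ?g x" for x
  proof -
    define s :: real where "s = (\<Sum>k\<in>S. indicator (A k) x)"
    have "(\<Sum>j\<in>S. \<Sum>k\<in>S. indicator (A j \<inter> A k) x) = s\<^sup>2"
      by (simp add: s_def power2_eq_square sum_product indicator_inter_arith)
    moreover have "2 * t * s - t\<^sup>2 * indicator ?U x \<le> s\<^sup>2"
    proof (cases "x \<in> ?U")
      case True
      have "0 \<le> (s - t)\<^sup>2" by simp
      with True show ?thesis by (simp add: power2_diff algebra_simps)
    next
      case False
      then have "s = 0" unfolding s_def by (intro sum.neutral) auto
      with False show ?thesis by simp
    qed
    ultimately show ?thesis by (simp add: s_def)
  qed
  have "integral\<^sup>L M ?f \<le> integral\<^sup>L M ?g"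
    using f g le by (intro integral_mono) (auto simp: has_bochner_integral_iff)
  then show ?thesis
    using f g by (simp only: has_bochner_integral_integral_eq)
qed

text \<open>Over a finite window whose weights \<open>a\<close> sum to \<open>s > 1\<close>, the
  number of events containing a point has first moment at least \<open>d * s\<close> and second
  moment at most \<open>(K + e) * s^2\<close>. The second moment bound then gives a lower bound on
  the measure of the union that does not depend on the window, so it holds for every tail.\<close>

lemma (in finite_measure) measure_limsup_pos_of_quasi_independent:
  fixes a :: "nat \<Rightarrow> real"
  assumes meas [measurable]: "\<And>k. A k \<in> sets M"
    and a: "\<And>k. 0 \<le> a k" and div: "\<not> summable a"
    and d: "0 < d" and lo: "\<And>k. d * a k \<le> measure M (A k)"
    and up: "\<And>k. measure M (A k) \<le> e * a k"
    and K: "0 \<le> K"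
    and quasi: "\<And>j k. m0 \<le> j \<Longrightarrow> j < k \<Longrightarrow> measure M (A j \<inter> A k) \<le> K * a j * a k"
  shows "0 < measure M (limsup A)"
proof -
  \<comment> \<open>A negative \<open>e\<close> would force every \<open>a k\<close> to vanish,
    contradicting divergence.\<close>
  have e: "0 \<le> e"
  proof (rule ccontr)
    assume "\<not> 0 \<le> e"
    then have "e * a k \<le> 0" for k using a[of k] by (simp add: mult_nonpos_nonneg)
    then have "d * a k \<le> 0" for k using lo[of k] up[of k] by (meson order_trans)
    then have "a k = 0" for k using a[of k] d by (simp add: mult_le_0_iff order_antisym)
    then have "a = (\<lambda>_. 0)" by auto
    with div show False by simp
  qed
  \<comment> \<open>\<open>K\<close> pays for the off-diagonal pairs and \<open>e\<close> for the
    diagonal; the extra 1 keeps \<open>L\<close> positive.\<close>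
  define L where "L = K + e + 1"
  have L: "0 < L" using K e by (simp add: L_def)
  have ge: "d\<^sup>2 / L \<le> measure M (\<Union>k\<in>{m..}. A k)" for m
  proof -
    \<comment> \<open>Starting at \<open>p\<close> keeps the window inside the tail from
      \<open>m\<close> and inside the range where \<open>quasi\<close> applies.\<close>
    define p where "p = max m m0"
    have "\<not> summable (\<lambda>k. a (k + p))" using div by simp
    \<comment> \<open>The threshold 1 is chosen so that \<open>s \<le> s^2\<close>, which lets the
      linear diagonal contribution be absorbed into the quadratic one.\<close>
    then have "\<exists>N. 1 < (\<Sum>k<N. a (k + p))"
      using summableI_nonneg_bounded[of "\<lambda>k. a (k + p)" 1] a by (force simp: not_less)
    then obtain N where "1 < (\<Sum>k<N. a (k + p))" by blast
    moreover define S where "S = (\<lambda>k. k + p) ` {..<N}"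
    define s where "s = (\<Sum>k\<in>S. a k)"
    ultimately have s: "1 < s" by (simp add: S_def sum.reindex inj_on_def)
    have fin: "finite S" and Sge: "\<And>k. k \<in> S \<Longrightarrow> p \<le> k" by (auto simp: S_def)
    \<comment> \<open>This choice makes \<open>2 * t * (d * s)\<close> exactly twice the second
      moment bound \<open>L * s^2\<close>, so one copy survives the subtraction.\<close>
    define t where "t = L * s / d"
    have t: "0 < t" using L s d by (simp add: t_def)
    have pair: "measure M (A j \<inter> A k) \<le> K * a j * a k + (if j = k then e * a j else 0)"
      if "j \<in> S" "k \<in> S" for j k
    proof (cases j k rule: linorder_cases)
      case less
      then show ?thesis using quasi[of j k] Sge[OF that(1)] by (simp add: p_def)
    next
      case equal
      then show ?thesis using up[of k] K a[of k] by (simp add: add_increasing)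
    next
      case greater
      then show ?thesis using quasi[of k j] Sge[OF that(2)]
        by (simp add: p_def Int_commute mult.commute mult.left_commute)
    qed
    have "(\<Sum>j\<in>S. \<Sum>k\<in>S. measure M (A j \<inter> A k))
        \<le> (\<Sum>j\<in>S. \<Sum>k\<in>S. K * a j * a k + (if j = k then e * a j else 0))"
      by (intro sum_mono pair)
    also have "\<dots> = K * s\<^sup>2 + e * s"
      using fin
      by (simp add: sum.distrib s_def power2_eq_square sum_product mult.assoc flip: sum_distrib_left)
    also have "\<dots> \<le> L * s\<^sup>2"
    proof -
      have "s \<le> s\<^sup>2" using s by (simp add: power2_eq_square)
      then have "e * s \<le> e * s\<^sup>2" using e by (rule mult_left_mono)
      then show ?thesis using zero_le_power2[of s] unfolding L_def distrib_right by linarith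
    qed
    finally have 1: "(\<Sum>j\<in>S. \<Sum>k\<in>S. measure M (A j \<inter> A k)) \<le> L * s\<^sup>2" .
    have "d * s \<le> (\<Sum>k\<in>S. measure M (A k))"
      unfolding s_def sum_distrib_left by (intro sum_mono lo)
    then have "2 * t * (d * s) \<le> 2 * t * (\<Sum>k\<in>S. measure M (A k))"
      using t by (intro mult_left_mono) auto
    moreover have "2 * t * (d * s) = 2 * (L * s\<^sup>2)"
      using d by (simp add: t_def power2_eq_square)
    ultimately have "L * s\<^sup>2 \<le> t\<^sup>2 * measure M (\<Union>k\<in>S. A k)"
      using second_moment_bound[of S A t, OF fin meas] 1 by linarith
    also have "\<dots> = (L * s\<^sup>2) * (L / d\<^sup>2 * measure M (\<Union>k\<in>S. A k))"
      by (simp add: t_def power2_eq_square)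
    finally have "(L * s\<^sup>2) * 1 \<le> (L * s\<^sup>2) * (L / d\<^sup>2 * measure M (\<Union>k\<in>S. A k))"
      by (simp only: mult_1_right)
    moreover have "0 < L * s\<^sup>2" using L s by simp
    ultimately have "1 \<le> L / d\<^sup>2 * measure M (\<Union>k\<in>S. A k)"
      by (simp only: mult_le_cancel_left_pos)
    then have "d\<^sup>2 / L \<le> measure M (\<Union>k\<in>S. A k)"
      using L d by (simp add: field_simps)
    also have "\<dots> \<le> measure M (\<Union>k\<in>{m..}. A k)"
      using Sge by (intro finite_measure_mono) (auto simp: p_def)
    finally show ?thesis .
  qed
  have "0 < d\<^sup>2 / L" using d L by simp
  also have "\<dots> \<le> measure M (limsup A)"
    by (rule measure_limsup_ge[OF meas ge])
  finally show ?thesis .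
qed

section \<open>Doubling functions, and reduction to a limit superior over levels\<close>

lemma doubling_iterate:
  fixes f :: "real \<Rightarrow> real"
  assumes c': "1 < c'" and c'': "1 < c''" and f: "\<And>x. 0 < x \<Longrightarrow> 0 < f x"
    and doubling: "\<And>x y. 0 < x \<Longrightarrow> 0 < y \<Longrightarrow> y \<le> c' * x \<Longrightarrow> f y \<le> c'' * f x"
  shows "\<exists>C\<ge>1. \<forall>x>0. \<forall>y>0. y \<le> c * x \<longrightarrow> f y \<le> C * f x"
proof -
  \<comment> \<open>Each application of doubling widens the admissible ratio by \<open>c'\<close> at
    the cost of a factor \<open>c''\<close>. The induction starts at exponent one, because at
    exponent zero the claim would be monotonicity of \<open>f\<close>.\<close>
  have it: "f y \<le> c'' ^ Suc k * f x" if "0 < x" "0 < y" "y \<le> c' ^ Suc k * x" for k x y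
    using that
  proof (induction k arbitrary: x)
    case 0
    then show ?case using doubling by simp
  next
    case (Suc k)
    have "f y \<le> c'' ^ Suc k * f (c' * x)"
      using Suc.prems c' by (intro Suc.IH) (auto simp: mult_ac)
    also have "\<dots> \<le> c'' ^ Suc k * (c'' * f x)"
      using Suc.prems c' c'' by (intro mult_left_mono doubling) auto
    finally show ?case by (simp add: mult_ac)
  qed
  obtain k where "c < c' ^ k" using real_arch_pow[OF c'] by blast
  also have "c' ^ k \<le> c' ^ Suc k" using c' by (intro power_increasing) auto
  finally have k: "c < c' ^ Suc k" .
  have "1 \<le> c'' ^ Suc k" using c'' by (intro one_le_power) auto
  moreover have "f y \<le> c'' ^ Suc k * f x" if "0 < x" "0 < y" "y \<le> c * x" for x y
    using that k by (intro it order_trans[OF that(3)] mult_right_mono) auto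
  ultimately show ?thesis by blast
qed

text \<open>As each level is finite, infinitely many indices must reach arbitrarily high levels, and
  conversely. This replaces the index set \<open>I\<close> by the natural numbers.\<close>

lemma Collect_infinite_eq_limsup:
  fixes n :: "'i \<Rightarrow> nat"
  assumes fin: "\<And>k. finite {i \<in> I. n i = k}"
    and sub: "\<And>i. i \<in> I \<Longrightarrow> X i \<subseteq> \<Omega>"
  shows "{z \<in> \<Omega>. infinite {i \<in> I. z \<in> X i}} = limsup (\<lambda>k. \<Union>i\<in>{i \<in> I. n i = k}. X i)"
proof -
  have inf_iff: "infinite {i \<in> I. z \<in> X i} \<longleftrightarrow> (\<forall>m. \<exists>i\<in>I. m \<le> n i \<and> z \<in> X i)" for z
  proof
    assume inf: "infinite {i \<in> I. z \<in> X i}"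
    show "\<forall>m. \<exists>i\<in>I. m \<le> n i \<and> z \<in> X i"
    proof (rule ccontr)
      assume "\<not> ?thesis"
      then obtain m where "\<And>i. i \<in> I \<Longrightarrow> z \<in> X i \<Longrightarrow> n i < m"
        by (meson not_le)
      then have "{i \<in> I. z \<in> X i} \<subseteq> (\<Union>k<m. {i \<in> I. n i = k})" by auto
      moreover have "finite (\<Union>k<m. {i \<in> I. n i = k})" using fin by simp
      ultimately show False using inf finite_subset by metis
    qed
  next
    assume unb: "\<forall>m. \<exists>i\<in>I. m \<le> n i \<and> z \<in> X i"
    have "infinite (n ` {i \<in> I. z \<in> X i})"
      unfolding infinite_nat_iff_unbounded_le image_iff using unb by (simp add: Bex_def) metis
    then show "infinite {i \<in> I. z \<in> X i}" by (metis finite_imageI)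
  qed
  have limsup_iff: "z \<in> limsup (\<lambda>k. \<Union>i\<in>{i \<in> I. n i = k}. X i)
      \<longleftrightarrow> (\<forall>m. \<exists>i\<in>I. m \<le> n i \<and> z \<in> X i)" for z
    by (simp add: limsup_INF_SUP Bex_def) metis
  show ?thesis
  proof (intro set_eqI iffI)
    fix z assume "z \<in> {z \<in> \<Omega>. infinite {i \<in> I. z \<in> X i}}"
    then have "infinite {i \<in> I. z \<in> X i}" by blast
    then show "z \<in> limsup (\<lambda>k. \<Union>i\<in>{i \<in> I. n i = k}. X i)"
      unfolding limsup_iff inf_iff .
  next
    fix z assume "z \<in> limsup (\<lambda>k. \<Union>i\<in>{i \<in> I. n i = k}. X i)"
    then have z: "\<forall>m. \<exists>i\<in>I. m \<le> n i \<and> z \<in> X i" unfolding limsup_iff .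
    with sub have "z \<in> \<Omega>" by (metis subsetD)
    with z show "z \<in> {z \<in> \<Omega>. infinite {i \<in> I. z \<in> X i}}"
      unfolding mem_Collect_eq inf_iff by (intro conjI)
  qed
qed

section \<open>The convergence and divergence criteria for the family \<open>B\<close>\<close>

theorem theorem3p1:
  fixes M :: "'z measure"
    and I :: "'i set"
    and B :: "'i \<Rightarrow> real \<Rightarrow> 'z set"
    and n :: "'i \<Rightarrow> nat"
    and f1 f2 f3 f4 :: "nat \<Rightarrow> real"
    and f5 :: "real \<Rightarrow> real"
    and E :: "'z set"
  assumes "finite_measure M"
    and "\<And>i \<epsilon>. i \<in> I \<Longrightarrow> \<epsilon> > 0 \<Longrightarrow> B i \<epsilon> \<in> sets M"
    and "\<And>i \<epsilon> \<epsilon>'. i \<in> I \<Longrightarrow> 0 < \<epsilon> \<Longrightarrow> \<epsilon> \<le> \<epsilon>' \<Longrightarrow> B i \<epsilon> \<subseteq> B i \<epsilon>'"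
    and "\<And>k. finite {i \<in> I. n i = k}"
    and "\<And>k. f1 k > 0" and "\<And>k. f2 k > 0" and "\<And>k. f3 k > 0" and "\<And>k. f4 k > 0"
    and "\<And>x. x > 0 \<Longrightarrow> f5 x > 0"
    and "E = {z \<in> space M. infinite {i \<in> I. z \<in> B i (f3 (n i))}}"
  shows "E \<in> sets M \<and>
    ((\<forall>k. f3 k \<le> f2 k) \<and>
     (\<exists>c\<ge>1. \<forall>k. \<forall>i\<in>I. \<forall>\<epsilon>\<in>{0<..f2 (n i)}.
        real (card {i \<in> I. n i = k}) \<le> c * f1 k \<and>
        measure M (B i \<epsilon>) \<le> c * f4 (n i) * f5 \<epsilon>) \<and>
     summable (\<lambda>k. f1 k * f4 k * f5 (f3 k))
     \<longrightarrow> measure M E = 0) \<and>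
    ((\<exists>c\<ge>1.
        (\<forall>k. f3 k \<le> f2 k) \<and>
        (\<forall>k. 1 / f5 (f2 k) \<le> f4 k * f1 k) \<and>
        (\<exists>c'>1. \<exists>c''>1. \<forall>\<epsilon>>0. \<forall>\<epsilon>'>0. \<epsilon>' \<le> c' * \<epsilon> \<longrightarrow> f5 \<epsilon>' \<le> c'' * f5 \<epsilon>) \<and>
        (\<forall>k. 1 / c * f1 k \<le> real (card {i \<in> I. n i = k}) \<and>
             real (card {i \<in> I. n i = k}) \<le> c * f1 k) \<and>
        (\<forall>i\<in>I. \<forall>\<epsilon>\<in>{0<..f2 (n i)}.
             1 / c * f4 (n i) * f5 \<epsilon> \<le> measure M (B i \<epsilon>) \<and>
             measure M (B i \<epsilon>) \<le> c * f4 (n i) * f5 \<epsilon>) \<and>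
        (\<forall>k. disjoint_family_on (\<lambda>i. B i (f2 k)) {i \<in> I. n i = k}) \<and>
        (\<forall>i\<in>I. \<forall>j\<in>I. n i < n j \<longrightarrow> B j (f3 (n j)) \<inter> B i (f3 (n i)) \<noteq> {} \<longrightarrow>
             B j (f2 (n j)) \<subseteq> B i (c * f3 (n i)))) \<and>
     \<not> summable (\<lambda>k. f1 k * f4 k * f5 (f3 k))
     \<longrightarrow> measure M E > 0)"
proof -
  interpret finite_measure M by fact
  note B_sets = assms(2) and B_mono = assms(3) and fin = assms(4)
    and pos = assms(5-8) and f5 = assms(9)
  define J where "J k = {i \<in> I. n i = k}" for k
  define A where "A k = (\<Union>i\<in>J k. B i (f3 k))" for k
  define a where "a k = f1 k * f4 k * f5 (f3 k)" for k
  have finJ: "finite (J k)" for k using fin by (simp add: J_def)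
  have J: "i \<in> I" "n i = k" if "i \<in> J k" for i k using that by (auto simp: J_def)
  have BJ [measurable]: "B i (f3 k) \<in> sets M" if "i \<in> I" for i k
    using that pos B_sets by auto
  have A_sets: "A k \<in> sets M" for k
    unfolding A_def using finJ BJ J by (intro sets.finite_UN) auto
  have a_pos: "0 < a k" for k using pos f5 by (simp add: a_def)
  have "E = limsup (\<lambda>k. \<Union>i\<in>{i \<in> I. n i = k}. B i (f3 (n i)))"
    unfolding assms(10) using BJ sets.sets_into_space
    by (intro Collect_infinite_eq_limsup fin) blast
  also have "(\<lambda>k. \<Union>i\<in>{i \<in> I. n i = k}. B i (f3 (n i))) = A"
    by (auto simp: A_def J_def fun_eq_iff)
  finally have E: "E = limsup A" .
  have E_sets: "E \<in> sets M" unfolding E using A_sets by measurable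
  \<comment> \<open>One factor \<open>c\<close> comes from the number of sets, the other from their
    measures. The cardinality bound is asked only for nonempty levels because in [A] it stands under
    a quantifier over \<open>i \<in> I\<close>, so an index is needed to extract it.\<close>
  have level_upper: "measure M (A k) \<le> c\<^sup>2 * a k"
    if "1 \<le> c" "J k \<noteq> {} \<Longrightarrow> real (card (J k)) \<le> c * f1 k"
      "\<And>i. i \<in> J k \<Longrightarrow> measure M (B i (f3 k)) \<le> c * f4 k * f5 (f3 k)" for c k
  proof (cases "J k = {}")
    case True
    then show ?thesis using a_pos[of k] by (simp add: A_def less_imp_le)
  next
    case False
    have "measure M (A k) \<le> (\<Sum>i\<in>J k. measure M (B i (f3 k)))"
      unfolding A_def using finJ BJ J by (intro finite_measure_subadditive_finite) auto
    also have "\<dots> \<le> real (card (J k)) * (c * f4 k * f5 (f3 k))"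
      using that(3) by (intro sum_bounded_above) auto
    also have "\<dots> \<le> (c * f1 k) * (c * f4 k * f5 (f3 k))"
      using that(1) that(2)[OF False] pos f5 by (intro mult_right_mono) (auto simp: less_imp_le)
    finally show ?thesis by (simp add: a_def power2_eq_square mult_ac)
  qed
  have part_A: "measure M E = 0"
    if le: "\<forall>k. f3 k \<le> f2 k" and c: "1 \<le> c"
      and h: "\<forall>k. \<forall>i\<in>I. \<forall>\<epsilon>\<in>{0<..f2 (n i)}. real (card {i \<in> I. n i = k}) \<le> c * f1 k \<and>
        measure M (B i \<epsilon>) \<le> c * f4 (n i) * f5 \<epsilon>"
      and summ: "summable a" for c
  proof -
    have level: "norm (measure M (A k)) \<le> c\<^sup>2 * a k" for k
      unfolding real_norm_def abs_of_nonneg[OF measure_nonneg]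
    proof (rule level_upper[OF c])
      have h': "real (card (J k)) \<le> c * f1 k \<and> measure M (B i (f3 k)) \<le> c * f4 k * f5 (f3 k)"
        if "i \<in> J k" for i
        using that h[rule_format, of i "f3 k" k] le pos by (auto simp: J_def)
      show "real (card (J k)) \<le> c * f1 k" if "J k \<noteq> {}"
        using that h' by blast
      show "measure M (B i (f3 k)) \<le> c * f4 k * f5 (f3 k)" if "i \<in> J k" for i
        using that h' by blast
    qed
    have "summable (\<lambda>k. measure M (A k))"
      by (rule summable_comparison_test'[OF summable_mult[OF summ] level])
    then have "limsup A \<in> null_sets M"
      by (intro borel_cantelli_limsup1 A_sets) (auto simp: less_top[symmetric])
    then show ?thesis by (simp add: E measure_eq_0_null_sets)
  qed
  have part_B: "0 < measure M E"
    if c: "1 \<le> c" and le: "\<And>k. f3 k \<le> f2 k"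
      and h2: "\<And>k. 1 / f5 (f2 k) \<le> f4 k * f1 k"
      and c': "1 < c'" and c'': "1 < c''"
      and h3: "\<And>x y. 0 < x \<Longrightarrow> 0 < y \<Longrightarrow> y \<le> c' * x \<Longrightarrow> f5 y \<le> c'' * f5 x"
      and h4: "\<And>k. f1 k / c \<le> real (card (J k)) \<and> real (card (J k)) \<le> c * f1 k"
      and h5: "\<And>k i \<epsilon>. i \<in> J k \<Longrightarrow> 0 < \<epsilon> \<Longrightarrow> \<epsilon> \<le> f2 k \<Longrightarrow>
             f4 k * f5 \<epsilon> / c \<le> measure M (B i \<epsilon>) \<and> measure M (B i \<epsilon>) \<le> c * f4 k * f5 \<epsilon>"
      and h6: "\<And>k. disjoint_family_on (\<lambda>i. B i (f2 k)) (J k)"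
      and h7: "\<And>l k i j. i \<in> J l \<Longrightarrow> j \<in> J k \<Longrightarrow> l < k \<Longrightarrow> B j (f3 k) \<inter> B i (f3 l) \<noteq> {} \<Longrightarrow>
             B j (f2 k) \<subseteq> B i (c * f3 l)"
      and div: "\<not> summable a" for c c' c''
  proof -
    \<comment> \<open>Doubling is needed for the ratio \<open>c\<close> of hypothesis (7): to
      compare \<open>f5 (c * f3 l)\<close> with \<open>f5 (f3 l)\<close>, and
      \<open>f5 (f2 k)\<close> with \<open>f5 (f3 k)\<close> when
      \<open>f2 k < c * f3 k\<close>.\<close>
    obtain C where C: "1 \<le> C" and dbl: "\<And>x y. 0 < x \<Longrightarrow> 0 < y \<Longrightarrow> y \<le> c * x \<Longrightarrow> f5 y \<le> C * f5 x"
      using doubling_iterate[of c' c'' f5 c, OF c' c'' f5 h3] by auto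
    \<comment> \<open>Hypothesis (2) without the division: up to constants, the sets of radius
      \<open>f2 k\<close> at level \<open>k\<close> have total measure bounded below.\<close>
    have f2_big: "1 \<le> f1 k * f4 k * f5 (f2 k)" for k
      using h2[of k] f5[of "f2 k"] pos by (simp add: field_simps)
    have lower: "a k / c\<^sup>2 \<le> measure M (A k)" for k
    proof -
      have "a k / c\<^sup>2 = (f1 k / c) * (f4 k * f5 (f3 k) / c)"
        by (simp add: a_def power2_eq_square)
      also have "\<dots> \<le> real (card (J k)) * (f4 k * f5 (f3 k) / c)"
        using c h4 pos f5 by (intro mult_right_mono) (auto simp: less_imp_le)
      also have "\<dots> \<le> (\<Sum>i\<in>J k. measure M (B i (f3 k)))"
        using h5 le pos by (intro sum_bounded_below) auto
      also have "\<dots> = measure M (A k)"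
        unfolding A_def
      proof (rule finite_measure_finite_Union[symmetric, OF finJ])
        show "(\<lambda>i. B i (f3 k)) ` J k \<subseteq> sets M" using BJ J by auto
        show "disjoint_family_on (\<lambda>i. B i (f3 k)) (J k)"
        unfolding disjoint_family_on_def
        proof (intro ballI impI)
          fix i j assume ij: "i \<in> J k" "j \<in> J k" "i \<noteq> j"
          then have "B i (f3 k) \<subseteq> B i (f2 k)" "B j (f3 k) \<subseteq> B j (f2 k)"
            using B_mono J(1) le pos by blast+
          moreover have "B i (f2 k) \<inter> B j (f2 k) = {}"
            using disjoint_family_onD[OF h6] ij by blast
          ultimately show "B i (f3 k) \<inter> B j (f3 k) = {}" by blast
        qed
      qed
      finally show ?thesis .
    qed
    show ?thesis
    \<comment> \<open>Hypothesis (7) leads to sets of radius \<open>c * f3 l\<close>, whose measure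
      (5) controls only up to radius \<open>f2 l\<close>.\<close>
    proof (cases "\<exists>m0. \<forall>k\<ge>m0. c * f3 k \<le> f2 k")
      case True
      then obtain m0 where m0: "\<And>k. m0 \<le> k \<Longrightarrow> c * f3 k \<le> f2 k" by blast
      have quasi: "measure M (A l \<inter> A k) \<le> (c^4 * C) * a l * a k" if l: "m0 \<le> l" and lk: "l < k" for l k
      proof -
        have each: "measure M (B i (f3 l) \<inter> A k) \<le> c ^ 3 * C * f4 l * f5 (f3 l) * a k"
          if i: "i \<in> J l" for i
        proof -
          \<comment> \<open>A packing argument bounds \<open>card T\<close>: for
            \<open>j \<in> T\<close> the sets \<open>B j (f2 k)\<close> are disjoint by (6), lie in
            \<open>B i (c * f3 l)\<close> by (7), and have measure bounded below by (5).\<close>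
          define T where "T = {j \<in> J k. B j (f3 k) \<inter> B i (f3 l) \<noteq> {}}"
          have finT: "finite T" and TJ: "T \<subseteq> J k" using finJ by (auto simp: T_def)
          have cf: "0 < c * f3 l" using c pos by simp
          have Bf2: "B j (f2 k) \<in> sets M" if "j \<in> J k" for j
            using that J B_sets pos by auto
          have Bi: "B i (c * f3 l) \<in> sets M" using B_sets J(1)[OF i] cf by auto
          have "real (card T) * (f4 k * f5 (f2 k) / c) \<le> (\<Sum>j\<in>T. measure M (B j (f2 k)))"
            using h5 TJ pos by (intro sum_bounded_below) auto
          also have "\<dots> = measure M (\<Union>j\<in>T. B j (f2 k))"
            using Bf2 TJ disjoint_family_on_mono[OF TJ h6]
            by (intro finite_measure_finite_Union[symmetric] finT) auto
          also have "\<dots> \<le> measure M (B i (c * f3 l))"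
            using h7[OF i _ lk] by (intro finite_measure_mono Bi) (auto simp: T_def)
          also have "\<dots> \<le> c * f4 l * f5 (c * f3 l)"
            using h5[OF i cf m0[OF l]] by simp
          also have "\<dots> \<le> c * f4 l * (C * f5 (f3 l))"
            using c pos cf by (intro mult_left_mono dbl) (auto simp: less_imp_le)
          finally have "real (card T) * (f4 k * f5 (f2 k) / c) * (c * f1 k)
              \<le> c * f4 l * (C * f5 (f3 l)) * (c * f1 k)"
            using c pos[of k] by (intro mult_right_mono) (auto simp: less_imp_le)
          then have "real (card T) * (f1 k * f4 k * f5 (f2 k)) \<le> c\<^sup>2 * C * f4 l * f5 (f3 l) * f1 k"
            using c by (simp add: power2_eq_square mult_ac)
          moreover have "real (card T) * 1 \<le> real (card T) * (f1 k * f4 k * f5 (f2 k))"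
            by (intro mult_left_mono f2_big) auto
          ultimately have T: "real (card T) \<le> c\<^sup>2 * C * f4 l * f5 (f3 l) * f1 k" by simp
          \<comment> \<open>The count came from the radius \<open>f2 k\<close>; the measure is now
            estimated at the smaller radius \<open>f3 k\<close>, which supplies the factor
            \<open>a k\<close>.\<close>
          have "measure M (B i (f3 l) \<inter> A k) \<le> measure M (\<Union>j\<in>T. B j (f3 k))"
            using finT TJ J BJ by (intro finite_measure_mono sets.finite_UN) (auto simp: A_def T_def)
          also have "\<dots> \<le> (\<Sum>j\<in>T. measure M (B j (f3 k)))"
            using finT TJ J BJ by (intro finite_measure_subadditive_finite) auto
          also have "\<dots> \<le> real (card T) * (c * f4 k * f5 (f3 k))"
            using h5 le pos TJ by (intro sum_bounded_above) auto
          also have "\<dots> \<le> (c\<^sup>2 * C * f4 l * f5 (f3 l) * f1 k) * (c * f4 k * f5 (f3 k))"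
            using c pos f5 by (intro mult_right_mono T) (auto simp: less_imp_le)
          finally show ?thesis by (simp add: a_def power2_eq_square power3_eq_cube mult_ac)
        qed
        have "A l \<inter> A k = (\<Union>i\<in>J l. B i (f3 l) \<inter> A k)" by (auto simp: A_def)
        moreover have "(\<lambda>i. B i (f3 l) \<inter> A k) ` J l \<subseteq> sets M"
          using J BJ A_sets by blast
        ultimately have "measure M (A l \<inter> A k) \<le> (\<Sum>i\<in>J l. measure M (B i (f3 l) \<inter> A k))"
          using finite_measure_subadditive_finite[OF finJ] by metis
        also have "\<dots> \<le> real (card (J l)) * (c ^ 3 * C * f4 l * f5 (f3 l) * a k)"
          using each by (intro sum_bounded_above) auto
        also have "\<dots> \<le> (c * f1 l) * (c ^ 3 * C * f4 l * f5 (f3 l) * a k)"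
          using c C h4 pos f5 a_pos by (intro mult_right_mono) (auto simp: less_imp_le)
        finally show ?thesis by (simp add: a_def power3_eq_cube power4_eq_xxxx mult_ac)
      qed
      show ?thesis unfolding E
      proof (rule measure_limsup_pos_of_quasi_independent[OF A_sets _ div _ _ _ _ quasi])
        show "0 < 1 / c\<^sup>2" "0 \<le> c ^ 4 * C" using c C by auto
        show "1 / c\<^sup>2 * a k \<le> measure M (A k)" for k using lower[of k] by simp
        show "measure M (A k) \<le> c\<^sup>2 * a k" for k
          using c h4 h5 le pos by (intro level_upper) auto
      qed (auto simp: a_pos less_imp_le)
    next
      case False
      \<comment> \<open>A single level suffices here: beyond any \<open>m\<close> some
        \<open>k\<close> has \<open>f2 k < c * f3 k\<close>, and then \<open>f2_big\<close> and
        doubling give \<open>1 \<le> C * a k\<close>, so \<open>A k\<close> alone has measure at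
        least the bound.\<close>
      have "1 / (C * c\<^sup>2) \<le> measure M (\<Union>k\<in>{m..}. A k)" for m
      proof -
        obtain k where k: "m \<le> k" "f2 k < c * f3 k" using False by (force simp: not_le)
        have "1 \<le> f1 k * f4 k * f5 (f2 k)" by (rule f2_big)
        also have "\<dots> \<le> f1 k * f4 k * (C * f5 (f3 k))"
          using k pos by (intro mult_left_mono dbl) (auto simp: less_imp_le)
        finally have "1 \<le> C * a k" by (simp add: a_def mult_ac)
        then have "1 / (C * c\<^sup>2) \<le> (C * a k) / (C * c\<^sup>2)"
          using C c by (intro divide_right_mono) auto
        also have "\<dots> = a k / c\<^sup>2" using C by simp
        also have "\<dots> \<le> measure M (A k)" by (rule lower)
        also have "\<dots> \<le> measure M (\<Union>k\<in>{m..}. A k)"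
          using k A_sets by (intro finite_measure_mono) auto
        finally show ?thesis .
      qed
      then have "1 / (C * c\<^sup>2) \<le> measure M E" unfolding E by (intro measure_limsup_ge A_sets)
      moreover have "0 < 1 / (C * c\<^sup>2)" using C c by simp
      ultimately show ?thesis by linarith
    qed
  qed
  have a_eq: "(\<lambda>k. f1 k * f4 k * f5 (f3 k)) = a" by (simp add: a_def fun_eq_iff)
  show ?thesis
    unfolding a_eq
  proof (intro conjI impI E_sets; elim conjE exE)
    fix c
    assume "\<forall>k. f3 k \<le> f2 k" "1 \<le> c" "summable a"
      "\<forall>k. \<forall>i\<in>I. \<forall>\<epsilon>\<in>{0<..f2 (n i)}. real (card {i \<in> I. n i = k}) \<le> c * f1 k \<and>
        measure M (B i \<epsilon>) \<le> c * f4 (n i) * f5 \<epsilon>"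
    then show "measure M E = 0" by (intro part_A)
  next
    fix c c' c'' :: real
    assume c: "1 \<le> c" "1 < c'" "1 < c''" "\<not> summable a" "\<forall>k. f3 k \<le> f2 k"
        "\<forall>k. 1 / f5 (f2 k) \<le> f4 k * f1 k"
        "\<forall>\<epsilon>>0. \<forall>\<epsilon>'>0. \<epsilon>' \<le> c' * \<epsilon> \<longrightarrow> f5 \<epsilon>' \<le> c'' * f5 \<epsilon>"
      and h4: "\<forall>k. 1 / c * f1 k \<le> real (card {i \<in> I. n i = k}) \<and>
             real (card {i \<in> I. n i = k}) \<le> c * f1 k"
      and h5: "\<forall>i\<in>I. \<forall>\<epsilon>\<in>{0<..f2 (n i)}.
             1 / c * f4 (n i) * f5 \<epsilon> \<le> measure M (B i \<epsilon>) \<and>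
             measure M (B i \<epsilon>) \<le> c * f4 (n i) * f5 \<epsilon>"
      and h6: "\<forall>k. disjoint_family_on (\<lambda>i. B i (f2 k)) {i \<in> I. n i = k}"
      and h7: "\<forall>i\<in>I. \<forall>j\<in>I. n i < n j \<longrightarrow> B j (f3 (n j)) \<inter> B i (f3 (n i)) \<noteq> {} \<longrightarrow>
             B j (f2 (n j)) \<subseteq> B i (c * f3 (n i))"
    show "0 < measure M E"
    proof (rule part_B[of c c' c''])
      show "f1 k / c \<le> real (card (J k)) \<and> real (card (J k)) \<le> c * f1 k" for k
        using h4 by (simp add: J_def)
      show "f4 k * f5 \<epsilon> / c \<le> measure M (B i \<epsilon>) \<and> measure M (B i \<epsilon>) \<le> c * f4 k * f5 \<epsilon>"
        if "i \<in> J k" "0 < \<epsilon>" "\<epsilon> \<le> f2 k" for k i \<epsilon>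
        using that h5 by (auto simp: J_def)
      show "disjoint_family_on (\<lambda>i. B i (f2 k)) (J k)" for k
        using h6 by (simp add: J_def)
      show "B j (f2 k) \<subseteq> B i (c * f3 l)"
        if "i \<in> J l" "j \<in> J k" "l < k" "B j (f3 k) \<inter> B i (f3 l) \<noteq> {}" for l k i j
        using that h7 by (auto simp: J_def)
    qed (use c in auto)
  qed
qed

end
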